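(* Let $\gamma\in(0,1)$ be a constant and $p=n^{-\gamma}$. There exists a constant $k\in\mathbb{N}$ (depending on $\gamma$) such that, for the planted subgraph detection task with $H$ a $k$-clique, counting constant-sized stars fails to achieve strong separation (i.e. for every $t=t_n\ge1$ with $t=O(1)$, the signed star count $f_{\mathbf{K}_{1,t}}$ does not strongly separate $\mathbb{P}$ and $\mathbb{Q}$), whereas some constant-degree polynomial achieves strong separation between $\mathbb{P}$ and $\mathbb{Q}$.
   Context: Asymptotics are as $n\to\infty$. $a_n=o(b_n)$ means $a_n/b_n\to0$ (in particular $b_n\neq 0$ for large $n$). A constant-degree polynomial means a (sequence of) polynomial(s) of degree $O(1)$. Graphs on vertex set $[n]$ are identified with vectors $G=(G_{\{i,j\}})\in\{0,1\}^{\binom n2}$ of edge indicators. $G(n,p)$ is the Erdős–Rényi random graph. Planted subgraph detection task: under the null $\mathbb{Q}=G(n,p)$ one observes $G(n,p)$; under $\mathbb{P}$ one observes the union of $G(n,p)$ with an independent random copy of $H$, chosen uniformly among all labelled copies of $H$ in the complete graph $K_n$ (i.e. the image of $H$ under a uniformly random injection $V(H)\to[n]$). A (sequence of) polynomial(s) $f$ in the $\binom n2$ variables $G_{\{i,j\}}$ strongly separates $\mathbb{P}$ and $\mathbb{Q}$ if $\max\{\sqrt{\mathrm{Var}_{\mathbb{P}}(f)},\sqrt{\mathrm{Var}_{\mathbb{Q}}(f)}\}=o(|\mathbb{E}_{\mathbb{P}}f-\mathbb{E}_{\mathbb{Q}}f|)$. For $S\subseteq\binom{[n]}{2}$, $\chi_S(G)=\prod_{\{i,j\}\in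 S}\frac{G_{\{i,j\}}-p}{\sqrt{p(1-p)}}$. For a graph $\mathbf{S}$ without isolated vertices, its signed count is $f_{\mathbf{S}}(G)=\sum_{S\subseteq\binom{[n]}{2}:\,S\cong\mathbf{S}}\chi_S(G)$. $\mathbf{K}_{1,t}$ is the star with $t$ edges. *)

theory Defs
  imports
    "HOL-Probability.Probability"
    "HOL-Library.Ramsey"
    "HOL-Library.Poly_Mapping"
    "HOL-Library.Landau_Symbols"
begin

type_synonym edge = "nat set"

text \<open>A graph on vertex set \<open>{1..n}\<close> is its vector of edge indicators, indexed by the edges
  \<open>nsets {1..n} 2\<close> of the complete graph; coordinates outside this index set are \<open>False\<close>.\<close>

type_synonym edge_vector = "edge \<Rightarrow> bool"

definition erdos_renyi :: "nat \<Rightarrow> real \<Rightarrow> edge_vector pmf" where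
  "erdos_renyi n p = Pi_pmf (nsets {1..n} 2) False (\<lambda>_. bernoulli_pmf p)"

definition random_injection :: "nat set \<Rightarrow> nat \<Rightarrow> (nat \<Rightarrow> nat) pmf" where
  "random_injection V n = pmf_of_set {\<phi> \<in> V \<rightarrow>\<^sub>E {1..n}. inj_on \<phi> V}"

text \<open>\<open>H = (V, E)\<close> is the planted graph. If \<open>n < card V\<close> there is no copy of \<open>H\<close> and the
  distribution below is unspecified; this concerns only finitely many \<open>n\<close> when \<open>V\<close> is fixed and
  finite.\<close>

definition planted :: "nat set \<times> edge set \<Rightarrow> nat \<Rightarrow> real \<Rightarrow> edge_vector pmf" where
  "planted H n p =
     do {
       G \<leftarrow> erdos_renyi n p;
       \<phi> \<leftarrow> random_injection (fst H) n;
       return_pmf (\<lambda>e. G e \<or> e \<in> (\<lambda>e'. \<phi> ` e') ` snd H)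
     }"

definition clique_graph :: "nat \<Rightarrow> nat set \<times> edge set" where
  "clique_graph k = ({1..k}, nsets {1..k} 2)"

text \<open>The eventual non-vanishing of the denominator is required explicitly because \<open>x / 0 = 0\<close>.\<close>

definition strongly_separates ::
  "(nat \<Rightarrow> 'a \<Rightarrow> real) \<Rightarrow> (nat \<Rightarrow> 'a pmf) \<Rightarrow> (nat \<Rightarrow> 'a pmf) \<Rightarrow> bool" where
  "strongly_separates f P Q \<longleftrightarrow>
     (let a = (\<lambda>n. max (sqrt (measure_pmf.variance (P n) (f n)))
                       (sqrt (measure_pmf.variance (Q n) (f n))));
          b = (\<lambda>n. \<bar>measure_pmf.expectation (P n) (f n) - measure_pmf.expectation (Q n) (f n)\<bar>)
      in (\<forall>\<^sub>F n in sequentially. b n \<noteq> 0) \<and> (\<lambda>n. a n / b n) \<longlonglongrightarrow> 0)"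

text \<open>Real polynomials in variables indexed by potential edges: a finitely supported map from
  monomials (finitely supported exponent vectors) to coefficients.\<close>

type_synonym edge_poly = "(edge \<Rightarrow>\<^sub>0 nat) \<Rightarrow>\<^sub>0 real"

definition poly_vars :: "edge_poly \<Rightarrow> edge set" where
  "poly_vars f = (\<Union>m \<in> Poly_Mapping.keys f. Poly_Mapping.keys m)"

definition total_degree :: "edge_poly \<Rightarrow> nat" where
  "total_degree f =
     Max (insert 0 ((\<lambda>m. \<Sum>e\<in>Poly_Mapping.keys m. Poly_Mapping.lookup m e) ` Poly_Mapping.keys f))"

definition eval_poly :: "edge_poly \<Rightarrow> edge_vector \<Rightarrow> real" where
  "eval_poly f G =
     (\<Sum>m\<in>Poly_Mapping.keys f. Poly_Mapping.lookup f m *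
        (\<Prod>e\<in>Poly_Mapping.keys m. of_bool (G e) ^ Poly_Mapping.lookup m e))"

definition chi :: "real \<Rightarrow> edge set \<Rightarrow> edge_vector \<Rightarrow> real" where
  "chi p S G = (\<Prod>e\<in>S. (of_bool (G e) - p) / sqrt (p * (1 - p)))"

text \<open>A graph without isolated vertices is determined by its edge set \<open>S\<close>, its vertex set being
  \<open>\<Union>S\<close>.\<close>

definition edge_set_iso :: "edge set \<Rightarrow> edge set \<Rightarrow> bool" where
  "edge_set_iso S T \<longleftrightarrow> (\<exists>\<phi>. bij_betw \<phi> (\<Union>S) (\<Union>T) \<and> (\<lambda>e. \<phi> ` e) ` S = T)"

definition signed_count :: "nat \<Rightarrow> real \<Rightarrow> edge set \<Rightarrow> edge_vector \<Rightarrow> real" where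
  "signed_count n p T G = (\<Sum>S | S \<subseteq> nsets {1..n} 2 \<and> edge_set_iso S T. chi p S G)"

definition star :: "nat \<Rightarrow> edge set" where
  "star t = {{0, i} | i. i \<in> {1..t}}"

end

theory Submission
  imports Defs "HOL-Real_Asymp.Real_Asymp"
begin

text \<open>
  Take \<open>k = 2 * j + 1\<close> with \<open>\<gamma> * j > 1\<close>, so that \<open>n * p ^ j\<close> tends to \<open>0\<close>. A clique on \<open>k\<close>
  vertices has average degree \<open>2 * j\<close>, hence \<open>j\<close> edges per vertex, and in \<open>G(n,p)\<close> each of its
  vertices costs a factor \<open>n * p ^ j\<close>: such cliques are too dense to appear by chance. The
  separating polynomial is therefore the plain (unsigned) number of \<open>k\<close>-cliques. With
  probability tending to one it is \<open>0\<close> under the null and \<open>1\<close> after planting.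

  Both variances come from one estimate. Let \<open>C\<close> be the planted vertex set, or the empty set under
  the null, and let \<open>X\<close> be the number of \<open>k\<close>-cliques not contained in \<open>C\<close>. Expanding \<open>X\<^sup>2\<close> as a sum
  over pairs \<open>(A, B)\<close>, a pair with \<open>U = (A \<union> B) - C\<close> uses at least \<open>j * card U\<close> edges outside \<open>C\<close>
  (\<open>card_new_edges_Un\<close>). At most \<open>64 ^ k\<close> pairs have the same \<open>U\<close>, and summing \<open>(p ^ j) ^ card U\<close>
  over all nonempty \<open>U\<close> gives \<open>(1 + p ^ j) ^ n - 1\<close>, which tends to \<open>0\<close>
  (\<open>second_moment_unplanted_cliques\<close>).

  Signed star counts fail for every clique of constant size, because a bounded number of vertices
  contains only a bounded number of stars. Under the null the functions \<open>chi p S\<close> are orthonormal,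
  so the variance is the number of stars with \<open>t\<close> edges in the complete graph, which is at least of
  order \<open>n ^ t\<close>. In the planted model only the copies inside the clique contribute to the mean, each
  of them at most \<open>(1 / p) powr (t / 2)\<close>. As \<open>n * p\<close> tends to infinity, the square of the mean,
  of order \<open>(1 / p) ^ t\<close>, stays below the variance (\<open>stars_not_strongly_separate\<close>).
\<close>

section \<open>Expectations under the null and planted distributions\<close>

definition add_clique :: "nat set \<Rightarrow> edge_vector \<Rightarrow> edge_vector" where
  "add_clique C G = (\<lambda>e. G e \<or> e \<in> nsets C 2)"

definition clique_count :: "nat \<Rightarrow> nat \<Rightarrow> edge_vector \<Rightarrow> real" where
  "clique_count n k G = (\<Sum>A\<in>nsets {1..n} k. \<Prod>e\<in>nsets A 2. of_bool (G e))"

lemma card_nsets: "finite A \<Longrightarrow> card (nsets A k) = card A choose k"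
  using n_subsets[of A k] by (simp add: nsets_def) (metis (no_types, lifting) Collect_cong finite_subset)

lemma finite_nsets [simp]: "finite A \<Longrightarrow> finite (nsets A k)"
  by (rule finite_imp_finite_nsets)

lemma nsets_Int: "nsets A k \<inter> nsets B k = nsets (A \<inter> B) k"
  by (auto simp: nsets_def)

lemma finite_set_erdos_renyi [simp]: "finite (set_pmf (erdos_renyi n p))"
  unfolding erdos_renyi_def
  by (intro finite_subset[OF set_Pi_pmf_subset'] finite_PiE_dflt) (auto intro: finite_subset[OF subset_UNIV])

lemma erdos_renyi_integrable [simp]:
  "integrable (measure_pmf (erdos_renyi n p)) (h :: _ \<Rightarrow> real)"
  by (rule integrable_measure_pmf_finite) simp

text \<open>The edge indicators are independent. The factors \<open>g e\<close> may be negative, as they are for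
  \<open>chi\<close>, so the proof uses the product rule for independent real random variables.\<close>

lemma erdos_renyi_expectation_prod:
  fixes g :: "edge \<Rightarrow> bool \<Rightarrow> real"
  assumes "0 \<le> p" "p \<le> 1" and S: "S \<subseteq> nsets {1..n} 2"
  shows "measure_pmf.expectation (erdos_renyi n p) (\<lambda>G. \<Prod>e\<in>S. g e (G e)) =
           (\<Prod>e\<in>S. p * g e True + (1 - p) * g e False)"
proof -
  have fin: "finite S" using S by (rule finite_subset) simp
  have "prob_space.indep_vars (measure_pmf (erdos_renyi n p)) (\<lambda>_. count_space UNIV) (\<lambda>e G. G e)
          (nsets {1..n} 2)"
    unfolding erdos_renyi_def by (rule indep_vars_Pi_pmf) simp
  then have "prob_space.indep_vars (measure_pmf (erdos_renyi n p)) (\<lambda>_. count_space UNIV) (\<lambda>e G. G e) S"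
    using S by (rule prob_space.indep_vars_subset[OF measure_pmf.prob_space_axioms])
  then have "prob_space.indep_vars (measure_pmf (erdos_renyi n p)) (\<lambda>_. borel) (\<lambda>e G. g e (G e)) S"
    by (rule prob_space.indep_vars_compose2[OF measure_pmf.prob_space_axioms]) simp
  then have "measure_pmf.expectation (erdos_renyi n p) (\<lambda>G. \<Prod>e\<in>S. g e (G e)) =
     (\<Prod>e\<in>S. measure_pmf.expectation (erdos_renyi n p) (\<lambda>G. g e (G e)))"
    using fin by (intro prob_space.indep_vars_lebesgue_integral[OF measure_pmf.prob_space_axioms]) auto
  also have "\<dots> = (\<Prod>e\<in>S. p * g e True + (1 - p) * g e False)"
  proof (rule prod.cong[OF refl])
    fix e assume "e \<in> S"
    then have e: "e \<in> nsets {1..n} 2" using S by blast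
    have "measure_pmf.expectation (erdos_renyi n p) (\<lambda>G. g e (G e)) =
          measure_pmf.expectation (map_pmf (\<lambda>G. G e) (erdos_renyi n p)) (g e)"
      by simp
    also have "map_pmf (\<lambda>G. G e) (erdos_renyi n p) = bernoulli_pmf p"
      unfolding erdos_renyi_def using e by (subst Pi_pmf_component) auto
    finally show "measure_pmf.expectation (erdos_renyi n p) (\<lambda>G. g e (G e)) =
        p * g e True + (1 - p) * g e False"
      using assms by (simp add: mult.commute)
  qed
  finally show ?thesis .
qed

lemma random_injection_clique:
  assumes "k \<le> n"
  shows "finite (set_pmf (random_injection {1..k} n))"
    and "\<phi> \<in> set_pmf (random_injection {1..k} n) \<Longrightarrow> inj_on \<phi> {1..k} \<and> \<phi> ` {1..k} \<subseteq> {1..n}"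
proof -
  let ?I = "{\<phi> \<in> {1..k} \<rightarrow>\<^sub>E {1..n}. inj_on \<phi> {1..k}}"
  have "restrict id {1..k} \<in> ?I" using assms by (auto simp: inj_on_def)
  then have ne: "?I \<noteq> {}" by blast
  have fin: "finite ?I" by (rule finite_subset[of _ "{1..k} \<rightarrow>\<^sub>E {1..n}"]) (auto intro: finite_PiE)
  have *: "set_pmf (random_injection {1..k} n) = ?I"
    unfolding random_injection_def using ne fin by (rule set_pmf_of_set)
  show "finite (set_pmf (random_injection {1..k} n))" using fin * by simp
  show "\<phi> \<in> set_pmf (random_injection {1..k} n) \<Longrightarrow> inj_on \<phi> {1..k} \<and> \<phi> ` {1..k} \<subseteq> {1..n}"
    unfolding * by auto
qed

lemma image_nsets: "inj_on f A \<Longrightarrow> (\<lambda>e. f ` e) ` nsets A k = nsets (f ` A) k"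
  using bij_betw_nsets[of f A "f ` A" k] by (simp add: bij_betw_def)

text \<open>Planting a clique depends on the random injection only through its image. Drawing the
  injection first turns the planted distribution into a mixture over vertex sets.\<close>

lemma planted_clique_mixture:
  assumes "k \<le> n"
  shows "planted (clique_graph k) n p =
    random_injection {1..k} n \<bind> (\<lambda>\<phi>. map_pmf (add_clique (\<phi> ` {1..k})) (erdos_renyi n p))"
proof -
  have "planted (clique_graph k) n p = random_injection {1..k} n \<bind> (\<lambda>\<phi>. erdos_renyi n p \<bind>
       (\<lambda>G. return_pmf (\<lambda>e. G e \<or> e \<in> (\<lambda>e'. \<phi> ` e') ` nsets {1..k} 2)))"
    unfolding planted_def clique_graph_def by (subst bind_commute_pmf) simp
  also have "\<dots> = random_injection {1..k} n \<bind>
      (\<lambda>\<phi>. map_pmf (add_clique (\<phi> ` {1..k})) (erdos_renyi n p))"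
    using random_injection_clique(2)[OF assms]
    by (intro bind_pmf_cong) (auto simp: map_pmf_def add_clique_def image_nsets)
  finally show ?thesis .
qed

lemma finite_set_planted_clique:
  assumes "k \<le> n"
  shows "finite (set_pmf (planted (clique_graph k) n p))"
  unfolding planted_clique_mixture[OF assms] using random_injection_clique(1)[OF assms] by auto

text \<open>As the planted distribution is a mixture over the clique position, estimates that are uniform
  in the position carry over. This reduces all computations to \<open>G(n,p)\<close> with a fixed clique.\<close>

lemma planted_clique_expectation_bounds:
  fixes h :: "edge_vector \<Rightarrow> real"
  assumes "k \<le> n"
    and bounds: "\<And>C. C \<subseteq> {1..n} \<Longrightarrow> card C = k \<Longrightarrow>
      measure_pmf.expectation (erdos_renyi n p) (\<lambda>G. h (add_clique C G)) \<in> {l..u}"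
  shows "measure_pmf.expectation (planted (clique_graph k) n p) h \<in> {l..u}"
proof -
  let ?I = "random_injection {1..k} n"
  let ?e = "\<lambda>\<phi>. measure_pmf.expectation (erdos_renyi n p) (\<lambda>G. h (add_clique (\<phi> ` {1..k}) G))"
  note fin = random_injection_clique(1)[OF assms(1)]
  have "measure_pmf.expectation (planted (clique_graph k) n p) h = (\<Sum>\<phi>\<in>set_pmf ?I. pmf ?I \<phi> *\<^sub>R ?e \<phi>)"
    unfolding planted_clique_mixture[OF assms(1)]
    using fin by (subst pmf_expectation_bind[OF fin]) auto
  also have "\<dots> = measure_pmf.expectation ?I ?e"
    using fin by (subst integral_measure_pmf[OF fin]) auto
  finally have eq: "measure_pmf.expectation (planted (clique_graph k) n p) h = measure_pmf.expectation ?I ?e" .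
  have int: "integrable (measure_pmf ?I) ?e" by (rule integrable_measure_pmf_finite[OF fin])
  have b: "?e \<phi> \<in> {l..u}" if "\<phi> \<in> set_pmf ?I" for \<phi>
    using random_injection_clique(2)[OF assms(1) that] by (intro bounds) (auto simp: card_image)
  show ?thesis
    unfolding eq atLeastAtMost_iff
    by (intro conjI measure_pmf.integral_ge_const[OF int] measure_pmf.integral_le_const[OF int])
       (use b in \<open>auto simp: AE_measure_pmf_iff\<close>)
qed

text \<open>The mean minimises the expected squared deviation.\<close>

lemma variance_le_expectation_square:
  fixes X :: "'a \<Rightarrow> real"
  assumes "finite (set_pmf M)"
  shows "measure_pmf.variance M X \<le> measure_pmf.expectation M (\<lambda>x. (X x - c)\<^sup>2)"
proof -
  have int: "integrable (measure_pmf M) (f :: 'a \<Rightarrow> real)" for f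
    by (rule integrable_measure_pmf_finite[OF assms])
  let ?\<mu> = "measure_pmf.expectation M X"
  have "measure_pmf.variance M X = measure_pmf.expectation M (\<lambda>x. (X x)\<^sup>2) - ?\<mu>\<^sup>2"
    by (rule measure_pmf.variance_eq) (auto intro: int)
  also have "\<dots> = measure_pmf.expectation M (\<lambda>x. (X x)\<^sup>2) - 2 * c * ?\<mu> + c\<^sup>2 - (?\<mu> - c)\<^sup>2"
    by (simp add: power2_eq_square algebra_simps)
  also have "measure_pmf.expectation M (\<lambda>x. (X x)\<^sup>2) - 2 * c * ?\<mu> + c\<^sup>2 =
       measure_pmf.expectation M (\<lambda>x. (X x - c)\<^sup>2)"
    by (simp add: power2_diff int algebra_simps)
  finally show ?thesis by simp
qed

section \<open>Second moment of the number of cliques\<close>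

text \<open>With \<open>x = card (A \<inter> C)\<close>, the right-hand side is \<open>(2 * j + 1 choose 2) - (x choose 2)\<close>. Here
  \<open>x choose 2\<close> is at most \<open>j * x\<close> because \<open>x - 1 \<le> 2 * j\<close>, and the two are equal for \<open>x = 2 * j + 1\<close>.\<close>

lemma card_new_edges:
  assumes "finite A" "card A = 2 * j + 1"
  shows "j * card (A - C) \<le> card (nsets A 2 - nsets C 2)"
proof -
  let ?x = "card (A \<inter> C)"
  have x: "?x \<le> 2 * j + 1" using assms by (metis card_mono inf_le1)
  have d: "card (A - C) = 2 * j + 1 - ?x" using assms by (simp add: card_Diff_subset_Int)
  have "card (nsets A 2 - nsets C 2) = card (nsets A 2) - card (nsets (A \<inter> C) 2)"
    using assms by (subst card_Diff_subset_Int) (auto simp: nsets_Int)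
  also have "\<dots> = ((2 * j + 1) choose 2) - (?x choose 2)"
    using assms by (simp add: card_nsets)
  finally have "card (nsets A 2 - nsets C 2) = ((2 * j + 1) choose 2) - (?x choose 2)" .
  moreover have "(2 * j + 1) choose 2 = j * (2 * j + 1)"
    by (simp add: choose_two)
  moreover have "?x choose 2 \<le> j * ?x"
  proof -
    have "?x * (?x - 1) \<le> ?x * (2 * j)" using x by (intro mult_left_mono) auto
    then show ?thesis unfolding choose_two
      by (metis div_le_mono mult.assoc mult.commute nonzero_mult_div_cancel_left zero_neq_numeral)
  qed
  ultimately show ?thesis unfolding d using x by (simp add: diff_mult_distrib2)
qed

text \<open>The edges of \<open>A\<close> that leave \<open>C\<close> and the edges of \<open>B\<close> that leave \<open>A \<union> C\<close> are disjoint, so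
  two applications of the bound for a single clique add up.\<close>

lemma card_new_edges_Un:
  assumes "finite A" "card A = 2 * j + 1" "finite B" "card B = 2 * j + 1"
  shows "j * card (A \<union> B - C) \<le> card (nsets A 2 \<union> nsets B 2 - nsets C 2)"
proof -
  have "A \<union> B - C = (A - C) \<union> (B - (A \<union> C))" by auto
  then have "j * card (A \<union> B - C) = j * card (A - C) + j * card (B - (A \<union> C))"
    using assms by (simp only:) (subst card_Un_disjoint, auto simp: algebra_simps)
  also have "\<dots> \<le> card (nsets A 2 - nsets C 2) + card (nsets B 2 - nsets (A \<union> C) 2)"
    using assms by (intro add_mono card_new_edges)
  also have "\<dots> = card ((nsets A 2 - nsets C 2) \<union> (nsets B 2 - nsets (A \<union> C) 2))"
    using assms nsets_mono[of A "A \<union> C" 2] by (intro card_Un_disjoint[symmetric]) auto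
  also have "\<dots> \<le> card (nsets A 2 \<union> nsets B 2 - nsets C 2)"
    using assms nsets_mono[of C "A \<union> C" 2] by (intro card_mono) auto
  finally show ?thesis .
qed

text \<open>The binomial theorem, in its form as a sum over subsets.\<close>

lemma sum_power_card_subsets:
  assumes "finite V"
  shows "(\<Sum>U\<in>Pow V. r ^ card U) = (1 + r :: 'a :: comm_semiring_1) ^ card V"
  using prod_add[OF assms, of "\<lambda>_. r" "\<lambda>_. 1"] by (simp add: add.commute)

lemma prod_of_bool:
  "finite S \<Longrightarrow> (\<Prod>e\<in>S. of_bool (P e)) = (of_bool (\<forall>e\<in>S. P e) :: 'a :: semidom)"
  by (induction S rule: finite_induct) auto

text \<open>The estimate behind both variance bounds: \<open>C\<close> is the planted set, or empty for the null. The
  condition on \<open>F\<close> makes every set \<open>A \<union> B - C\<close> nonempty, which removes the term \<open>1\<close> from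
  \<open>(1 + p ^ j) ^ n\<close>. Without it the bound would not tend to \<open>0\<close>.\<close>

lemma second_moment_unplanted_cliques:
  fixes p :: real
  assumes p: "0 \<le> p" "p \<le> 1" and k: "k = 2 * j + 1" and C: "C \<subseteq> {1..n}" "card C \<le> k"
    and F: "F \<subseteq> nsets {1..n} k" "\<And>A. A \<in> F \<Longrightarrow> \<not> A \<subseteq> C"
  shows "measure_pmf.expectation (erdos_renyi n p)
           (\<lambda>G. (\<Sum>A\<in>F. \<Prod>e\<in>nsets A 2. of_bool (add_clique C G e))\<^sup>2)
         \<le> 64 ^ k * ((1 + p ^ j) ^ n - 1)"
proof -
  define r where "r = p ^ j"
  have r: "0 \<le> r" using p by (simp add: r_def)
  have finF: "finite F" using F(1) by (rule finite_subset) simp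
  have finC: "finite C" using C(1) by (rule finite_subset) simp
  have FD: "finite A" "card A = k" "A \<subseteq> {1..n}" if "A \<in> F" for A
    using that F(1) by (auto simp: nsets_def)
  let ?U = "\<lambda>(A, B). A \<union> B - C"
  let ?R = "Pow {1..n} - {{}}"
  have "(measure_pmf.expectation (erdos_renyi n p)
           (\<lambda>G. (\<Sum>A\<in>F. \<Prod>e\<in>nsets A 2. of_bool (add_clique C G e))\<^sup>2) :: real)
     = measure_pmf.expectation (erdos_renyi n p) (\<lambda>G. \<Sum>(A, B)\<in>F \<times> F.
         (\<Prod>e\<in>nsets A 2. of_bool (add_clique C G e)) * (\<Prod>e\<in>nsets B 2. of_bool (add_clique C G e)))"
    by (simp only: power2_eq_square sum_product sum.cartesian_product)
  also have "\<dots> = (\<Sum>(A, B)\<in>F \<times> F. measure_pmf.expectation (erdos_renyi n p)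
           (\<lambda>G. (\<Prod>e\<in>nsets A 2. of_bool (add_clique C G e)) * (\<Prod>e\<in>nsets B 2. of_bool (add_clique C G e))))"
    unfolding split_def by (rule Bochner_Integration.integral_sum) simp
  also have "\<dots> \<le> (\<Sum>x\<in>F \<times> F. r ^ card (?U x))"
  proof (intro sum_mono, clarify)
    fix A B assume AB: "A \<in> F" "B \<in> F"
    let ?S = "nsets A 2 \<union> nsets B 2"
    have S: "?S \<subseteq> nsets {1..n} 2" using FD(3)[OF AB(1)] FD(3)[OF AB(2)] nsets_mono by (metis Un_least)
    have finS: "finite ?S" using S by (rule finite_subset) simp
    have *: "(\<Prod>e\<in>nsets A 2. of_bool (add_clique C G e)) * (\<Prod>e\<in>nsets B 2. of_bool (add_clique C G e))
         = (\<Prod>e\<in>?S. (of_bool (G e \<or> e \<in> nsets C 2) :: real))" for G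
    proof -
      have fin: "finite (nsets A 2)" "finite (nsets B 2)"
        using FD(1)[OF AB(1)] FD(1)[OF AB(2)] by simp_all
      show ?thesis
        unfolding add_clique_def prod_of_bool[OF fin(1)] prod_of_bool[OF fin(2)] prod_of_bool[OF finS]
          ball_Un of_bool_conj ..
    qed
    have "measure_pmf.expectation (erdos_renyi n p)
           (\<lambda>G. (\<Prod>e\<in>nsets A 2. of_bool (add_clique C G e)) * (\<Prod>e\<in>nsets B 2. of_bool (add_clique C G e)))
        = (\<Prod>e\<in>?S. p * of_bool (True \<or> e \<in> nsets C 2) + (1 - p) * of_bool (False \<or> e \<in> nsets C 2))"
      unfolding * by (rule erdos_renyi_expectation_prod[OF p S])
    also have "\<dots> = (\<Prod>e\<in>?S. if e \<in> nsets C 2 then 1 else p)"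
      by (intro prod.cong) auto
    also have "\<dots> = p ^ card (?S - nsets C 2)"
      using finS by (simp add: prod.If_cases Diff_eq)
    also have "\<dots> \<le> p ^ (j * card (A \<union> B - C))"
      using p card_new_edges_Un[of A j B C] FD[OF AB(1)] FD[OF AB(2)] k by (intro power_decreasing) auto
    also have "\<dots> = r ^ card (A \<union> B - C)" by (simp add: r_def power_mult)
    finally show "measure_pmf.expectation (erdos_renyi n p)
           (\<lambda>G. (\<Prod>e\<in>nsets A 2. of_bool (add_clique C G e)) * (\<Prod>e\<in>nsets B 2. of_bool (add_clique C G e)))
       \<le> r ^ card (A \<union> B - C)" .
  qed
  \<comment> \<open>Group the pairs by the set of their vertices outside \<open>C\<close>.\<close>
  also have "\<dots> = (\<Sum>U\<in>?R. real (card {x \<in> F \<times> F. ?U x = U}) * r ^ card U)"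
  proof (rule sum_fun_comp)
    show "?U ` (F \<times> F) \<subseteq> ?R"
    proof (rule image_subsetI, clarify)
      fix A B assume AB: "A \<in> F" "B \<in> F"
      have "A \<union> B - C \<noteq> {}" using F(2)[OF AB(1)] by blast
      moreover have "A \<union> B - C \<subseteq> {1..n}" using FD(3)[OF AB(1)] FD(3)[OF AB(2)] by blast
      ultimately show "A \<union> B - C \<in> ?R" by blast
    qed
  qed (use finF in simp_all)
  also have "\<dots> \<le> (\<Sum>U\<in>?R. 64 ^ k * r ^ card U)"
  proof (intro sum_mono mult_right_mono)
    fix U assume "U \<in> ?R"
    show "real (card {x \<in> F \<times> F. ?U x = U}) \<le> 64 ^ k"
    proof (cases "{x \<in> F \<times> F. ?U x = U} = {}")
      case False
      then obtain A B where AB: "A \<in> F" "B \<in> F" "A \<union> B - C = U" by auto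
      \<comment> \<open>Both members of a pair in the fibre of \<open>U\<close> are subsets of \<open>U \<union> C\<close>, which has at most
        \<open>3 * k\<close> elements; there are at most \<open>(2 ^ (3 * k))\<^sup>2 = 64 ^ k\<close> such pairs.\<close>
      have "card (U \<union> C) \<le> card (A \<union> B) + card C"
      proof -
        have "card (U \<union> C) \<le> card ((A \<union> B) \<union> C)"
          using AB(3) FD(1)[OF AB(1)] FD(1)[OF AB(2)] finC by (intro card_mono) auto
        also have "\<dots> \<le> card (A \<union> B) + card C" by (rule card_Un_le)
        finally show ?thesis .
      qed
      also have "\<dots> \<le> 3 * k"
        using card_Un_le[of A B] FD(2)[OF AB(1)] FD(2)[OF AB(2)] C(2) by simp
      finally have c: "card (U \<union> C) \<le> 3 * k" .
      have fin: "finite (U \<union> C)" using AB(3) FD(1)[OF AB(1)] FD(1)[OF AB(2)] finC by auto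
      have "card {x \<in> F \<times> F. ?U x = U} \<le> card (Pow (U \<union> C) \<times> Pow (U \<union> C))"
        using fin by (intro card_mono) auto
      also have "\<dots> = 4 ^ card (U \<union> C)"
        using fin by (simp add: card_cartesian_product card_Pow flip: power_mult_distrib)
      also have "\<dots> \<le> 4 ^ (3 * k)" using c by (intro power_increasing) auto
      also have "\<dots> = 64 ^ k" by (simp add: power_mult)
      finally have "real (card {x \<in> F \<times> F. ?U x = U}) \<le> real (64 ^ k)" by (rule of_nat_mono)
      then show ?thesis by (simp only: of_nat_power of_nat_numeral)
    next
      case True
      then show ?thesis by (simp only: card.empty of_nat_0) simp
    qed
  qed (use r in auto)
  also have "\<dots> = 64 ^ k * ((\<Sum>U\<in>Pow {1..n}. r ^ card U) - 1)"
    by (subst sum_distrib_left[symmetric], subst sum_diff1) simp_all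
  also have "\<dots> = 64 ^ k * ((1 + r) ^ n - 1)"
    by (simp add: sum_power_card_subsets)
  finally show ?thesis by (simp add: r_def)
qed


section \<open>Counting cliques separates\<close>

lemma clique_count_add_clique:
  assumes "C \<subseteq> {1..n}" "card C = k"
  shows "clique_count n k (add_clique C G) =
    1 + (\<Sum>A\<in>nsets {1..n} k - {C}. \<Prod>e\<in>nsets A 2. of_bool (add_clique C G e))"
proof -
  have "C \<in> nsets {1..n} k" using assms by (auto simp: nsets_def intro: finite_subset)
  moreover have "(\<Prod>e\<in>nsets C 2. of_bool (add_clique C G e) :: real) = 1"
    by (intro prod.neutral) (auto simp: add_clique_def)
  ultimately show ?thesis by (simp add: clique_count_def sum.remove)
qed

lemma add_clique_empty [simp]: "add_clique {} G = G"
  by (auto simp: add_clique_def nsets_def)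

text \<open>The count is a natural number. So its second moment also bounds its mean.\<close>

lemma clique_count_le_square: "clique_count n k G \<le> (clique_count n k G)\<^sup>2"
proof -
  obtain m where "clique_count n k G = real m"
  proof
    show "clique_count n k G = real (\<Sum>A\<in>nsets {1..n} k. \<Prod>e\<in>nsets A 2. of_bool (G e))"
      by (simp add: clique_count_def)
  qed
  then show ?thesis by (cases m) (auto simp: power2_eq_square)
qed

lemma clique_count_null_square:
  assumes "0 \<le> p" "p \<le> 1" and k: "k = 2 * j + 1"
  shows "measure_pmf.expectation (erdos_renyi n p) (\<lambda>G. (clique_count n k G)\<^sup>2)
     \<le> 64 ^ k * ((1 + p ^ j) ^ n - 1)"
proof -
  have "\<not> A \<subseteq> {}" if "A \<in> nsets {1..n} k" for A
    using that k by (auto simp: nsets_def)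
  then show ?thesis
    using second_moment_unplanted_cliques[OF assms, of "{}" n "nsets {1..n} k"]
    by (simp add: clique_count_def)
qed

lemma clique_count_planted:
  assumes "0 \<le> p" "p \<le> 1" and k: "k = 2 * j + 1" and "k \<le> n"
  shows "measure_pmf.expectation (planted (clique_graph k) n p) (\<lambda>G. (clique_count n k G - 1)\<^sup>2)
     \<in> {0..64 ^ k * ((1 + p ^ j) ^ n - 1)}"
proof (rule planted_clique_expectation_bounds[OF \<open>k \<le> n\<close>])
  fix C :: "nat set" assume C: "C \<subseteq> {1..n}" "card C = k"
  have nsub: "\<not> A \<subseteq> C" if "A \<in> nsets {1..n} k - {C}" for A
    using that C by (auto simp: nsets_def dest: card_subset_eq[rotated] intro: finite_subset)
  have "measure_pmf.expectation (erdos_renyi n p) (\<lambda>G. (clique_count n k (add_clique C G) - 1)\<^sup>2)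
     \<le> 64 ^ k * ((1 + p ^ j) ^ n - 1)"
    unfolding clique_count_add_clique[OF C]
    using second_moment_unplanted_cliques[OF assms(1-3) C(1), of "nsets {1..n} k - {C}"] C(2) nsub by simp
  then show "measure_pmf.expectation (erdos_renyi n p) (\<lambda>G. (clique_count n k (add_clique C G) - 1)\<^sup>2)
     \<in> {0..64 ^ k * ((1 + p ^ j) ^ n - 1)}"
    by (auto intro: integral_nonneg_AE)
qed

lemma clique_count_planted_mean:
  assumes "k \<le> n"
  shows "1 \<le> measure_pmf.expectation (planted (clique_graph k) n p) (clique_count n k)"
proof -
  let ?P = "planted (clique_graph k) n p"
  have "1 \<le> clique_count n k G" if "G \<in> set_pmf ?P" for G
  proof -
    from that obtain \<phi> G' where "\<phi> \<in> set_pmf (random_injection {1..k} n)"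
      and G: "G = add_clique (\<phi> ` {1..k}) G'"
      unfolding planted_clique_mixture[OF assms] by auto
    then have C: "\<phi> ` {1..k} \<subseteq> {1..n}" "card (\<phi> ` {1..k}) = k"
      using random_injection_clique(2)[OF assms] by (auto simp: card_image)
    show ?thesis unfolding G clique_count_add_clique[OF C] by (simp add: sum_nonneg prod_nonneg)
  qed
  then show ?thesis
    by (intro measure_pmf.integral_ge_const integrable_measure_pmf_finite finite_set_planted_clique assms)
       (auto simp: AE_measure_pmf_iff)
qed

text \<open>If \<open>\<delta>\<close> denotes the second moment bound, both variances are at most \<open>\<delta>\<close>. The null mean is at
  most \<open>\<delta>\<close> and the planted mean at least \<open>1\<close>, since the planted clique itself is counted.\<close>

theorem clique_count_strongly_separates:
  assumes p: "\<And>n. 0 \<le> p n" "\<And>n. p n \<le> 1" and k: "k = 2 * j + 1"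
    and lim: "(\<lambda>n. real n * p n ^ j) \<longlonglongrightarrow> 0"
  shows "strongly_separates (\<lambda>n. clique_count n k)
           (\<lambda>n. planted (clique_graph k) n (p n)) (\<lambda>n. erdos_renyi n (p n))"
proof -
  define \<delta> where "\<delta> n = 64 ^ k * ((1 + p n ^ j) ^ n - 1)" for n
  let ?P = "\<lambda>n. planted (clique_graph k) n (p n)" and ?Q = "\<lambda>n. erdos_renyi n (p n)"
  let ?f = "\<lambda>n. clique_count n k"
  define a where "a n = max (sqrt (measure_pmf.variance (?P n) (?f n)))
                            (sqrt (measure_pmf.variance (?Q n) (?f n)))" for n
  define b where "b n = \<bar>measure_pmf.expectation (?P n) (?f n) - measure_pmf.expectation (?Q n) (?f n)\<bar>" for n
  have \<delta>0: "0 \<le> \<delta> n" for n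
    using p[of n] by (simp add: \<delta>_def one_le_power)
  have "\<delta> n \<le> 64 ^ k * (exp (real n * p n ^ j) - 1)" for n
  proof -
    have "(1 + p n ^ j) ^ n \<le> exp (p n ^ j) ^ n"
      using p[of n] exp_ge_add_one_self[of "p n ^ j"] by (intro power_mono) auto
    then show ?thesis by (simp add: \<delta>_def exp_of_nat_mult)
  qed
  moreover have "(\<lambda>n. 64 ^ k * (exp (real n * p n ^ j) - 1)) \<longlonglongrightarrow> 64 ^ k * (exp 0 - 1)"
    by (intro tendsto_intros lim)
  ultimately have \<delta>: "\<delta> \<longlonglongrightarrow> 0"
    by (intro tendsto_sandwich[of "\<lambda>_. 0" \<delta> sequentially "\<lambda>n. 64 ^ k * (exp (real n * p n ^ j) - 1)"]
          always_eventually allI \<delta>0) auto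
  have a: "a n \<le> sqrt (\<delta> n)" if n: "n \<ge> k" for n
  proof -
    have "measure_pmf.variance (?P n) (?f n) \<le> \<delta> n"
      using variance_le_expectation_square[OF finite_set_planted_clique[OF n, of "p n"], of "?f n" 1]
        clique_count_planted[OF p[of n] k n]
      by (auto simp: \<delta>_def)
    moreover have "measure_pmf.variance (?Q n) (?f n) \<le> \<delta> n"
      using variance_le_expectation_square[OF finite_set_erdos_renyi[of n "p n"], of "?f n" 0]
        clique_count_null_square[OF p[of n] k, of n]
      by (auto simp: \<delta>_def)
    ultimately show ?thesis by (simp add: a_def)
  qed
  have b: "1 - \<delta> n \<le> b n" if n: "n \<ge> k" for n
  proof -
    have "measure_pmf.expectation (?Q n) (?f n) \<le> measure_pmf.expectation (?Q n) (\<lambda>G. (?f n G)\<^sup>2)"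
      by (intro integral_mono clique_count_le_square) auto
    also have "\<dots> \<le> \<delta> n"
      unfolding \<delta>_def by (rule clique_count_null_square[OF p[of n] k])
    finally show ?thesis using clique_count_planted_mean[OF n, of "p n"] by (simp add: b_def)
  qed
  have small: "eventually (\<lambda>n. n \<ge> k \<and> \<delta> n < 1) sequentially"
    using eventually_ge_at_top[of k] order_tendstoD(2)[OF \<delta> zero_less_one] by (rule eventually_conj)
  have nz: "eventually (\<lambda>n. b n \<noteq> 0) sequentially"
    using small by eventually_elim (use b in force)
  have "(\<lambda>n. a n / b n) \<longlonglongrightarrow> 0"
  proof (rule tendsto_sandwich)
    show "eventually (\<lambda>n. 0 \<le> a n / b n) sequentially"
      by (auto simp: a_def b_def le_max_iff_disj intro!: divide_nonneg_nonneg integral_nonneg_AE)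
    show "eventually (\<lambda>n. a n / b n \<le> sqrt (\<delta> n) / (1 - \<delta> n)) sequentially"
      using small by eventually_elim (use a b \<delta>0 in \<open>auto intro!: frac_le\<close>)
    have "(\<lambda>n. sqrt (\<delta> n) / (1 - \<delta> n)) \<longlonglongrightarrow> sqrt 0 / (1 - 0)"
      by (intro tendsto_intros \<delta>) auto
    then show "(\<lambda>n. sqrt (\<delta> n) / (1 - \<delta> n)) \<longlonglongrightarrow> 0" by simp
  qed auto
  with nz show ?thesis by (simp add: strongly_separates_def a_def b_def Let_def)
qed

section \<open>The clique count as a polynomial\<close>

definition edge_monomial :: "edge set \<Rightarrow> edge \<Rightarrow>\<^sub>0 nat" where
  "edge_monomial S = (\<Sum>e\<in>S. Poly_Mapping.single e 1)"

text \<open>The sum ranges over the set of monomials instead of the vertex sets, so that the coefficients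
  are \<open>1\<close> for every \<open>k\<close>. For \<open>k = 1\<close> all \<open>n\<close> cliques have the same monomial \<open>1\<close>, and for
  \<open>n \<ge> 2\<close> the polynomial differs from the clique count.\<close>

definition clique_poly :: "nat \<Rightarrow> nat \<Rightarrow> edge_poly" where
  "clique_poly n k = (\<Sum>m\<in>(\<lambda>A. edge_monomial (nsets A 2)) ` nsets {1..n} k. Poly_Mapping.single m 1)"

lemma lookup_edge_monomial: "finite S \<Longrightarrow> Poly_Mapping.lookup (edge_monomial S) e = of_bool (e \<in> S)"
  by (simp add: edge_monomial_def lookup_sum lookup_single when_def)

lemma keys_edge_monomial: "finite S \<Longrightarrow> Poly_Mapping.keys (edge_monomial S) = S"
  by (auto simp: in_keys_iff lookup_edge_monomial)

lemma lookup_clique_poly: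
  "Poly_Mapping.lookup (clique_poly n k) m = of_bool (m \<in> (\<lambda>A. edge_monomial (nsets A 2)) ` nsets {1..n} k)"
  unfolding clique_poly_def lookup_sum lookup_single when_def by (subst sum.delta) auto

lemma keys_clique_poly:
  "Poly_Mapping.keys (clique_poly n k) = (\<lambda>A. edge_monomial (nsets A 2)) ` nsets {1..n} k"
  by (auto simp: in_keys_iff lookup_clique_poly split: if_splits)

lemma Union_nsets_2: "card A \<ge> 2 \<Longrightarrow> \<Union>(nsets A 2) = A"
proof (intro equalityI subsetI)
  fix x assume "card A \<ge> 2" "x \<in> A"
  then have "A \<noteq> {x}" by auto
  then obtain y where "y \<in> A" "y \<noteq> x" using \<open>x \<in> A\<close> by auto
  then show "x \<in> \<Union>(nsets A 2)" using \<open>x \<in> A\<close> by (intro UnionI[of "{x, y}"]) auto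
qed (auto simp: nsets_def)

text \<open>For \<open>k \<ge> 2\<close> a vertex set is the union of its edges. Hence different vertex sets give
  different monomials.\<close>

lemma eval_clique_poly:
  assumes "k \<ge> 2"
  shows "eval_poly (clique_poly n k) G = clique_count n k G"
proof -
  have fin: "finite (nsets A 2)" if "A \<in> nsets {1..n} k" for A
    using that by (auto simp: nsets_def)
  have inj: "inj_on (\<lambda>A. edge_monomial (nsets A 2)) (nsets {1..n} k)"
  proof (rule inj_onI)
    fix A B assume A: "A \<in> nsets {1..n} k" and B: "B \<in> nsets {1..n} k"
      and "edge_monomial (nsets A 2) = edge_monomial (nsets B 2)"
    then have "nsets A 2 = nsets B 2" by (metis fin keys_edge_monomial)
    then show "A = B" using A B assms Union_nsets_2[of A] Union_nsets_2[of B] by (simp add: nsets_def)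
  qed
  show ?thesis
    unfolding eval_poly_def clique_count_def keys_clique_poly sum.reindex[OF inj] o_def
    by (intro sum.cong refl) (auto simp: lookup_clique_poly keys_edge_monomial lookup_edge_monomial fin intro!: prod.cong)
qed

lemma poly_vars_clique_poly: "poly_vars (clique_poly n k) \<subseteq> nsets {1..n} 2"
proof -
  have "finite (nsets A 2)" "nsets A 2 \<subseteq> nsets {1..n} 2" if "A \<in> nsets {1..n} k" for A
    using that by (auto simp: nsets_def)
  then show ?thesis by (auto simp: poly_vars_def keys_clique_poly keys_edge_monomial)
qed

lemma total_degree_clique_poly: "total_degree (clique_poly n k) \<le> k choose 2"
proof -
  have "(\<Sum>e\<in>Poly_Mapping.keys m. Poly_Mapping.lookup m e) = k choose 2"
    if "m \<in> Poly_Mapping.keys (clique_poly n k)" for m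
  proof -
    from that obtain A where A: "A \<in> nsets {1..n} k" "m = edge_monomial (nsets A 2)"
      by (auto simp: keys_clique_poly)
    then have "finite A" "card A = k" by (auto simp: nsets_def)
    then show ?thesis by (simp add: A(2) keys_edge_monomial lookup_edge_monomial card_nsets)
  qed
  then show ?thesis unfolding total_degree_def by (subst Max_le_iff) auto
qed

section \<open>Moments of signed counts\<close>

text \<open>An edge outside the clique contributes a centred factor, which makes the product vanish. An
  edge inside the clique is present with certainty and contributes
  \<open>(1 - p) / sqrt (p * (1 - p)) = sqrt ((1 - p) / p)\<close>.\<close>

lemma expectation_chi_add_clique:
  assumes p: "0 < p" "p < 1" and S: "S \<subseteq> nsets {1..n} 2"
  shows "measure_pmf.expectation (erdos_renyi n p) (\<lambda>G. chi p S (add_clique C G)) =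
     of_bool (S \<subseteq> nsets C 2) * sqrt ((1 - p) / p) ^ card S"
proof -
  let ?s = "sqrt (p * (1 - p))"
  have fin: "finite S" using S by (rule finite_subset) simp
  have "measure_pmf.expectation (erdos_renyi n p) (\<lambda>G. chi p S (add_clique C G)) =
     (\<Prod>e\<in>S. p * ((of_bool (True \<or> e \<in> nsets C 2) - p) / ?s) +
              (1 - p) * ((of_bool (False \<or> e \<in> nsets C 2) - p) / ?s))"
    unfolding chi_def add_clique_def
    using erdos_renyi_expectation_prod[OF _ _ S, of p "\<lambda>e b. (of_bool (b \<or> e \<in> nsets C 2) - p) / ?s"] p
    by simp
  also have "\<dots> = (\<Prod>e\<in>S. if e \<in> nsets C 2 then sqrt ((1 - p) / p) else 0)"
  proof (rule prod.cong[OF refl])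
    fix e
    have "(1 - p) / ?s = ((1 - p) / sqrt (1 - p)) / sqrt p"
      by (simp add: real_sqrt_mult)
    also have "\<dots> = sqrt ((1 - p) / p)"
      using p by (simp add: real_div_sqrt real_sqrt_divide)
    finally have *: "sqrt ((1 - p) / p) = (1 - p) / ?s" ..
    show "p * ((of_bool (True \<or> e \<in> nsets C 2) - p) / ?s) +
              (1 - p) * ((of_bool (False \<or> e \<in> nsets C 2) - p) / ?s)
       = (if e \<in> nsets C 2 then sqrt ((1 - p) / p) else 0)"
      unfolding * by (cases "e \<in> nsets C 2") (simp_all add: divide_inverse algebra_simps)
  qed
  also have "\<dots> = of_bool (S \<subseteq> nsets C 2) * sqrt ((1 - p) / p) ^ card S"
  proof (cases "S \<subseteq> nsets C 2")
    case True
    then have "(\<Prod>e\<in>S. if e \<in> nsets C 2 then sqrt ((1 - p) / p) else 0) = (\<Prod>e\<in>S. sqrt ((1 - p) / p))"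
      by (intro prod.cong) auto
    then show ?thesis using True by simp
  next
    case False
    then show ?thesis using fin by (auto intro!: prod_zero)
  qed
  finally show ?thesis .
qed

text \<open>Orthonormality: an edge in exactly one of \<open>S\<close> and \<open>T\<close> contributes its mean \<open>0\<close>, an edge in
  both contributes its variance \<open>1\<close>.\<close>

lemma expectation_chi_mult_chi:
  assumes p: "0 < p" "p < 1" and S: "S \<subseteq> nsets {1..n} 2" and T: "T \<subseteq> nsets {1..n} 2"
  shows "measure_pmf.expectation (erdos_renyi n p) (\<lambda>G. chi p S G * chi p T G) = of_bool (S = T)"
proof -
  define c where "c b = (of_bool b - p) / sqrt (p * (1 - p))" for b
  let ?g = "\<lambda>e b. (if e \<in> S then c b else 1) * (if e \<in> T then c b else 1)"
  have ST: "S \<union> T \<subseteq> nsets {1..n} 2" using S T by simp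
  then have fin: "finite (S \<union> T)" by (rule finite_subset) simp
  have mean: "p * c True + (1 - p) * c False = 0"
    by (simp add: c_def algebra_simps flip: add_divide_distrib)
  have "(c True)\<^sup>2 = (1 - p) / p" "(c False)\<^sup>2 = p / (1 - p)"
    using p by (simp_all add: c_def power_divide) (simp_all add: power2_eq_square)
  then have var: "p * (c True * c True) + (1 - p) * (c False * c False) = 1"
    using p by (simp add: power2_eq_square)
  have eq: "chi p S G * chi p T G = (\<Prod>e\<in>S \<union> T. ?g e (G e))" for G
  proof -
    have "chi p S G = (\<Prod>e\<in>S \<union> T. if e \<in> S then c (G e) else 1)"
      using fin by (simp add: chi_def c_def prod.If_cases Int_absorb1)
    moreover have "chi p T G = (\<Prod>e\<in>S \<union> T. if e \<in> T then c (G e) else 1)"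
      using fin by (simp add: chi_def c_def prod.If_cases Int_absorb1)
    ultimately show ?thesis by (simp only: prod.distrib)
  qed
  have "measure_pmf.expectation (erdos_renyi n p) (\<lambda>G. chi p S G * chi p T G) =
     (\<Prod>e\<in>S \<union> T. p * ?g e True + (1 - p) * ?g e False)"
    unfolding eq using p by (intro erdos_renyi_expectation_prod[OF _ _ ST]) auto
  also have "\<dots> = (\<Prod>e\<in>S \<union> T. of_bool (e \<in> S \<inter> T))"
    using mean var by (intro prod.cong) auto
  also have "\<dots> = of_bool (S = T)"
    using fin by (auto simp: prod_zero_iff)
  finally show ?thesis .
qed

lemma card_edge_set_iso: "edge_set_iso S T \<Longrightarrow> card S = card T"
proof -
  assume "edge_set_iso S T"
  then obtain \<phi> where \<phi>: "bij_betw \<phi> (\<Union>S) (\<Union>T)" "(\<lambda>e. \<phi> ` e) ` S = T"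
    by (auto simp: edge_set_iso_def)
  have "inj_on (\<lambda>e. \<phi> ` e) S"
    using \<phi>(1) by (intro inj_on_subset[OF inj_on_image_Pow]) (auto simp: bij_betw_def)
  then show ?thesis using \<phi>(2) card_image by metis
qed

definition copies :: "nat \<Rightarrow> edge set \<Rightarrow> edge set set" where
  "copies n T = {S. S \<subseteq> nsets {1..n} 2 \<and> edge_set_iso S T}"

lemma finite_copies [simp]: "finite (copies n T)"
  by (rule finite_subset[of _ "Pow (nsets {1..n} 2)"]) (auto simp: copies_def)

lemma signed_count_copies: "signed_count n p T G = (\<Sum>S\<in>copies n T. chi p S G)"
  by (simp add: signed_count_def copies_def)

lemma signed_count_add_clique_mean:
  assumes p: "0 < p" "p < 1"
  shows "measure_pmf.expectation (erdos_renyi n p) (\<lambda>G. signed_count n p T (add_clique C G)) =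
    card (copies n T \<inter> Pow (nsets C 2)) * sqrt ((1 - p) / p) ^ card T"
proof -
  have "measure_pmf.expectation (erdos_renyi n p) (\<lambda>G. signed_count n p T (add_clique C G)) =
     (\<Sum>S\<in>copies n T. measure_pmf.expectation (erdos_renyi n p) (\<lambda>G. chi p S (add_clique C G)))"
    unfolding signed_count_copies by (rule Bochner_Integration.integral_sum) simp
  also have "\<dots> = (\<Sum>S\<in>copies n T. of_bool (S \<subseteq> nsets C 2) * sqrt ((1 - p) / p) ^ card T)"
    using expectation_chi_add_clique[OF p] by (intro sum.cong) (auto simp: copies_def card_edge_set_iso)
  also have "\<dots> = (\<Sum>S\<in>copies n T. of_bool (S \<subseteq> nsets C 2)) * sqrt ((1 - p) / p) ^ card T"
    by (rule sum_distrib_right[symmetric])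
  also have "(\<Sum>S\<in>copies n T. of_bool (S \<subseteq> nsets C 2) :: real) = card (copies n T \<inter> Pow (nsets C 2))"
    by (simp add: Int_def Pow_def flip: sum.inter_filter)
  finally show ?thesis .
qed

lemma signed_count_null_mean:
  assumes "0 < p" "p < 1" "card T > 0"
  shows "measure_pmf.expectation (erdos_renyi n p) (signed_count n p T) = 0"
proof -
  have "{} \<notin> copies n T"
    using assms(3) card_edge_set_iso[of "{}" T] by (auto simp: copies_def)
  then have "copies n T \<inter> Pow (nsets {} 2) = {}"
    by (auto simp: nsets_empty_iff)
  then show ?thesis using signed_count_add_clique_mean[OF assms(1,2), of n T "{}"] by simp
qed

text \<open>Orthonormality leaves only the diagonal terms of the squared sum.\<close>

lemma signed_count_null_variance:
  assumes p: "0 < p" "p < 1" "card T > 0"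
  shows "measure_pmf.variance (erdos_renyi n p) (signed_count n p T) = card (copies n T)"
proof -
  have "measure_pmf.variance (erdos_renyi n p) (signed_count n p T) =
      measure_pmf.expectation (erdos_renyi n p) (\<lambda>G. \<Sum>(S, S')\<in>copies n T \<times> copies n T. chi p S G * chi p S' G)"
    unfolding signed_count_null_mean[OF p]
    by (simp only: signed_count_copies power2_eq_square sum_product sum.cartesian_product diff_0_right)
  also have "\<dots> = (\<Sum>(S, S')\<in>copies n T \<times> copies n T. measure_pmf.expectation (erdos_renyi n p)
      (\<lambda>G. chi p S G * chi p S' G))"
    unfolding split_def by (rule Bochner_Integration.integral_sum) simp
  also have "\<dots> = (\<Sum>(S, S')\<in>copies n T \<times> copies n T. of_bool (S = S'))"
    using expectation_chi_mult_chi[OF p(1,2)] by (intro sum.cong) (auto simp: copies_def)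
  also have "\<dots> = (\<Sum>S\<in>copies n T. \<Sum>S'\<in>copies n T. of_bool (S = S'))"
    by (rule sum.cartesian_product[symmetric])
  also have "\<dots> = card (copies n T)" by (simp add: of_bool_def)
  finally show ?thesis .
qed

text \<open>Copies of \<open>T\<close> inside the planted clique are subsets of its \<open>k choose 2\<close> edges, so their number
  is bounded independently of \<open>n\<close>.\<close>

lemma signed_count_planted_clique_mean:
  assumes p: "0 < p" "p < 1" and "k \<le> n"
  shows "measure_pmf.expectation (planted (clique_graph k) n p) (signed_count n p T) \<in>
     {0..2 ^ (k choose 2) * sqrt (1 / p) ^ card T}"
proof (rule planted_clique_expectation_bounds[OF \<open>k \<le> n\<close>])
  fix C :: "nat set" assume C: "C \<subseteq> {1..n}" "card C = k"
  have finC: "finite C" using C(1) by (rule finite_subset) simp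
  have "card (copies n T \<inter> Pow (nsets C 2)) \<le> card (Pow (nsets C 2))"
    using finC by (intro card_mono) auto
  also have "\<dots> = 2 ^ (k choose 2)" using finC C(2) by (simp add: card_Pow card_nsets)
  finally have "real (card (copies n T \<inter> Pow (nsets C 2))) \<le> real (2 ^ (k choose 2))"
    by (rule of_nat_mono)
  then have "real (card (copies n T \<inter> Pow (nsets C 2))) \<le> 2 ^ (k choose 2)"
    by (simp only: of_nat_power of_nat_numeral)
  moreover have "sqrt ((1 - p) / p) ^ card T \<le> sqrt (1 / p) ^ card T"
    using p by (intro power_mono real_sqrt_le_mono divide_right_mono) auto
  ultimately show "measure_pmf.expectation (erdos_renyi n p) (\<lambda>G. signed_count n p T (add_clique C G)) \<in>
     {0..2 ^ (k choose 2) * sqrt (1 / p) ^ card T}"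
    unfolding signed_count_add_clique_mean[OF p] using p by (auto intro!: mult_mono mult_nonneg_nonneg zero_le_power)
qed

section \<open>Signed star counts fail\<close>

text \<open>A quotient that tends to \<open>0\<close> is eventually less than \<open>1\<close>. So strong separation fails if the
  standard deviation under \<open>Q\<close> reaches the mean difference infinitely often.\<close>

lemma not_strongly_separates_if_mean_le_variance:
  assumes "frequently (\<lambda>n. (measure_pmf.expectation (P n) (f n) - measure_pmf.expectation (Q n) (f n))\<^sup>2
     \<le> measure_pmf.variance (Q n) (f n)) sequentially"
  shows "\<not> strongly_separates f P Q"
proof
  assume sep: "strongly_separates f P Q"
  let ?a = "\<lambda>n. max (sqrt (measure_pmf.variance (P n) (f n))) (sqrt (measure_pmf.variance (Q n) (f n)))"
  let ?b = "\<lambda>n. \<bar>measure_pmf.expectation (P n) (f n) - measure_pmf.expectation (Q n) (f n)\<bar>"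
  from sep have nz: "eventually (\<lambda>n. ?b n \<noteq> 0) sequentially" and lim: "(\<lambda>n. ?a n / ?b n) \<longlonglongrightarrow> 0"
    by (simp_all add: strongly_separates_def Let_def)
  have "eventually (\<lambda>n. ?a n / ?b n < 1) sequentially"
    using order_tendstoD(2)[OF lim, of 1] by simp
  with nz have "eventually (\<lambda>n. \<not> (measure_pmf.expectation (P n) (f n) - measure_pmf.expectation (Q n) (f n))\<^sup>2
     \<le> measure_pmf.variance (Q n) (f n)) sequentially"
  proof eventually_elim
    case (elim n)
    then have "?a n < ?b n" by (simp add: divide_less_eq split: if_splits)
    then have "sqrt (measure_pmf.variance (Q n) (f n)) < ?b n" by simp
    then show ?case by (metis linorder_not_le real_sqrt_le_iff real_sqrt_abs)
  qed
  with assms show False by (simp add: frequently_def)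
qed

lemma star_image: "star t = (\<lambda>i. {0, i}) ` {1..t}"
  by (auto simp: star_def)

lemma card_star: "card (star t) = t"
proof -
  have "inj_on (\<lambda>i::nat. {0, i}) {1..t}" by (auto simp: inj_on_def doubleton_eq_iff)
  then show ?thesis by (simp add: star_image card_image)
qed

lemma edge_set_iso_star:
  assumes "finite I" "card I = t" "x \<notin> I" "t \<ge> 1"
  shows "edge_set_iso ((\<lambda>i. {x, i}) ` I) (star t)"
proof -
  obtain h where h: "bij_betw h I {1..t}"
    using ex_bij_betw_nat_finite_1[of I] assms(1,2) bij_betw_inv by blast
  define \<phi> where "\<phi> = h(x := 0)"
  have \<phi>: "\<phi> x = 0" "\<phi> i = h i" if "i \<in> I" for i
    using that assms(3) by (auto simp: \<phi>_def)
  have "I \<noteq> {}" using assms by auto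
  then have U: "\<Union>((\<lambda>i. {x, i}) ` I) = insert x I" by auto
  have U': "\<Union>(star t) = insert 0 {1..t}" using assms(4) by (auto simp: star_image)
  have "bij_betw \<phi> (insert x I) (insert 0 {1..t})"
  proof (rule bij_betw_combine[where A = "{x}" and B = "{0}", simplified insert_is_Un[symmetric] Un_insert_left sup_bot_left])
    show "bij_betw \<phi> {x} {0}" by (simp add: \<phi>_def)
    show "bij_betw \<phi> I {1..t}" using h \<phi>(2) by (metis bij_betw_cong)
  qed auto
  moreover have "(\<lambda>e. \<phi> ` e) ` ((\<lambda>i. {x, i}) ` I) = star t"
  proof -
    have "(\<lambda>e. \<phi> ` e) ` ((\<lambda>i. {x, i}) ` I) = (\<lambda>i. {0, i}) ` (h ` I)"
      unfolding image_image using \<phi> by (intro image_cong) auto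
    also have "h ` I = {1..t}" using h by (simp add: bij_betw_def)
    finally show ?thesis by (auto simp: star_def)
  qed
  ultimately show ?thesis unfolding edge_set_iso_def U U' by blast
qed

text \<open>The stars centred at vertex \<open>1\<close> already number \<open>(n - 1) choose t\<close>. Leaving out the other centres
  loses a factor of order \<open>n\<close>, which is affordable since \<open>n * p\<close> alone tends to infinity.\<close>

lemma card_copies_star:
  assumes "t \<ge> 1" "n \<ge> 1"
  shows "(n - 1) choose t \<le> card (copies n (star t))"
proof -
  have "(n - 1) choose t = card (nsets {2..n} t)" by (simp add: card_nsets)
  also have "\<dots> \<le> card (copies n (star t))"
  proof (rule card_inj_on_le[where f = "\<lambda>I. (\<lambda>i. {1, i}) ` I"])
    show "inj_on (\<lambda>I. (\<lambda>i. {1, i}) ` I) (nsets {2..n} t)"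
      by (rule inj_on_subset[OF inj_on_image_Pow[where A = "{2..n}"]])
         (auto simp: inj_on_def doubleton_eq_iff nsets_def)
    show "(\<lambda>I. (\<lambda>i. {1, i}) ` I) ` nsets {2..n} t \<subseteq> copies n (star t)"
    proof safe
      fix I assume I: "I \<in> nsets {2..n} t"
      then have "edge_set_iso ((\<lambda>i. {1, i}) ` I) (star t)"
        using assms by (intro edge_set_iso_star) (auto simp: nsets_def)
      moreover have "(\<lambda>i. {1, i}) ` I \<subseteq> nsets {1..n} 2"
        using I assms(2) by (auto simp: nsets_def[of "{2..n}"])
      ultimately show "(\<lambda>i. {1, i}) ` I \<in> copies n (star t)" by (simp add: copies_def)
    qed
  qed simp
  finally show ?thesis .
qed

text \<open>The squared mean is at most \<open>K * (1 / p) ^ t\<close> with a constant \<open>K\<close>, and the variance is at least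
  \<open>((n - 1) / t) ^ t\<close>. Since \<open>K \<ge> 1\<close> and \<open>t \<ge> 1\<close>, replacing \<open>K\<close> by \<open>K ^ t\<close> only weakens the first
  bound, and the comparison reduces to that of the bases: \<open>K * t \<le> (n - 1) * p\<close>. A bound \<open>T\<close> on
  the number of edges makes this hold for all large \<open>n\<close>.\<close>

theorem stars_not_strongly_separate:
  fixes p :: "nat \<Rightarrow> real" and t :: "nat \<Rightarrow> nat"
  assumes p: "\<forall>\<^sub>F n in sequentially. 0 < p n \<and> p n < 1"
    and lim: "filterlim (\<lambda>n. real n * p n) at_top sequentially"
    and t: "\<And>n. t n \<ge> 1" "\<forall>\<^sub>F n in sequentially. t n \<le> T"
  shows "\<not> strongly_separates (\<lambda>n. signed_count n (p n) (star (t n)))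
            (\<lambda>n. planted (clique_graph k) n (p n)) (\<lambda>n. erdos_renyi n (p n))"
proof -
  define K :: real where "K = (2 ^ (k choose 2))\<^sup>2"
  have K1: "1 \<le> K" unfolding K_def by (simp add: one_le_power)
  \<comment> \<open>The summand \<open>1\<close> pays for passing from \<open>n\<close> to \<open>n - 1\<close>, which costs \<open>p n \<le> 1\<close>.\<close>
  have "eventually (\<lambda>n. real n * p n \<ge> K * T + 1) sequentially"
    using lim by (simp add: filterlim_at_top)
  with p t(2) eventually_ge_at_top[of "k + T + 1"]
  have "eventually (\<lambda>n.
     (measure_pmf.expectation (planted (clique_graph k) n (p n)) (signed_count n (p n) (star (t n))) -
      measure_pmf.expectation (erdos_renyi n (p n)) (signed_count n (p n) (star (t n))))\<^sup>2
     \<le> measure_pmf.variance (erdos_renyi n (p n)) (signed_count n (p n) (star (t n)))) sequentially"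
  proof eventually_elim
    case (elim n)
    then have p01: "0 < p n" "p n < 1" and n: "k \<le> n" "t n \<le> n - 1" "1 \<le> n" by auto
    let ?t = "t n"
    have pos: "card (star ?t) > 0" using t(1)[of n] by (simp add: card_star)
    let ?\<mu> = "measure_pmf.expectation (planted (clique_graph k) n (p n)) (signed_count n (p n) (star ?t))"
    have "?\<mu>\<^sup>2 \<le> (2 ^ (k choose 2) * sqrt (1 / p n) ^ ?t)\<^sup>2"
      using signed_count_planted_clique_mean[OF p01 n(1), of "star ?t"]
      by (intro power_mono) (auto simp: card_star)
    also have "\<dots> = K * (sqrt (1 / p n) ^ 2) ^ ?t"
      by (simp only: K_def power_mult_distrib flip: power_mult) (simp add: mult.commute)
    also have "\<dots> = K * (1 / p n) ^ ?t" using p01 by simp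
    also have "\<dots> \<le> K ^ ?t * (1 / p n) ^ ?t"
      using K1 t(1)[of n] p01 by (intro mult_right_mono self_le_power) auto
    also have "\<dots> = (K / p n) ^ ?t" by (simp add: power_mult_distrib power_divide)
    also have "\<dots> \<le> (real (n - 1) / real ?t) ^ ?t"
    proof (rule power_mono)
      have "K * real ?t \<le> K * T" using K1 elim by (intro mult_left_mono) auto
      also have "\<dots> \<le> real n * p n - 1" using elim by simp
      also have "\<dots> \<le> real (n - 1) * p n" using n(3) p01 by (simp add: of_nat_diff algebra_simps)
      finally show "K / p n \<le> real (n - 1) / real ?t"
        using p01 t(1)[of n] by (simp add: field_simps)
      show "0 \<le> K / p n" using K1 p01 by simp
    qed
    also have "\<dots> \<le> real ((n - 1) choose ?t)"
      using binomial_ge_n_over_k_pow_k[OF n(2), where 'a = real] by simp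
    also have "\<dots> \<le> real (card (copies n (star ?t)))"
      using card_copies_star[OF t(1)[of n] n(3)] by simp
    finally show ?case
      unfolding signed_count_null_variance[OF p01 pos]
      unfolding signed_count_null_mean[OF p01 pos] by simp
  qed
  then show ?thesis
    by (intro not_strongly_separates_if_mean_le_variance eventually_frequently) auto
qed

theorem lemma4p1:
  fixes \<gamma> :: real and p :: "nat \<Rightarrow> real"
  assumes "0 < \<gamma>" and "\<gamma> < 1"
    and "\<And>n. p n = real n powr (- \<gamma>)"
  shows "\<exists>k :: nat.
     (\<forall>t :: nat \<Rightarrow> nat. (\<forall>n. t n \<ge> 1) \<longrightarrow> (\<lambda>n. real (t n)) \<in> O(\<lambda>_. 1) \<longrightarrow>
        \<not> strongly_separates (\<lambda>n. signed_count n (p n) (star (t n)))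
            (\<lambda>n. planted (clique_graph k) n (p n)) (\<lambda>n. erdos_renyi n (p n))) \<and>
     (\<exists>f :: nat \<Rightarrow> edge_poly.
        (\<forall>n. poly_vars (f n) \<subseteq> nsets {1..n} 2) \<and>
        (\<lambda>n. real (total_degree (f n))) \<in> O(\<lambda>_. 1) \<and>
        strongly_separates (\<lambda>n. eval_poly (f n))
          (\<lambda>n. planted (clique_graph k) n (p n)) (\<lambda>n. erdos_renyi n (p n)))"
proof -
  note p_eq = assms(3)
  \<comment> \<open>The number \<open>j\<close> of edges per clique vertex must satisfy \<open>\<gamma> * j > 1\<close>, for \<open>n * p ^ j\<close> to tend
    to \<open>0\<close>.\<close>
  obtain j :: nat where j: "1 / \<gamma> < j" using reals_Archimedean2 by blast
  have \<gamma>j: "\<gamma> * j > 1" using j assms(1) by (simp add: field_simps)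
  define k where "k = 2 * j + 1"
  have "j \<ge> 1" using \<gamma>j by (cases j) auto
  then have k2: "k \<ge> 2" by (simp add: k_def)
  have p0: "0 \<le> p n" for n by (simp add: p_eq)
  have p1: "p n \<le> 1" for n
  proof (cases "n = 0")
    case False
    then have "real n powr (- \<gamma>) \<le> real n powr 0" using assms(1) by (intro powr_mono) auto
    then show ?thesis using False by (simp add: p_eq)
  qed (simp add: p_eq)
  have p01: "\<forall>\<^sub>F n in sequentially. 0 < p n \<and> p n < 1"
    using eventually_gt_at_top[of 1]
  proof eventually_elim
    case (elim n)
    then have "real n powr (- \<gamma>) < real n powr 0" using assms(1) by (intro powr_less_mono) auto
    then show ?case using elim by (simp add: p_eq)
  qed
  have np: "filterlim (\<lambda>n. real n * p n) at_top sequentially"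
    unfolding p_eq using assms(2) by real_asymp
  have "(\<lambda>n. real n powr (1 - \<gamma> * j)) \<longlonglongrightarrow> 0"
    using \<gamma>j by real_asymp
  moreover have "\<forall>\<^sub>F n in sequentially. real n powr (1 - \<gamma> * j) = real n * p n ^ j"
    using eventually_gt_at_top[of 0]
  proof eventually_elim
    case (elim n)
    then have "real n * p n ^ j = real n powr 1 * (real n powr (- \<gamma>)) powr j"
      by (simp add: p_eq powr_realpow)
    also have "\<dots> = real n powr (1 - \<gamma> * j)"
      unfolding powr_powr powr_add[symmetric] by simp
    finally show ?case ..
  qed
  ultimately have npj: "(\<lambda>n. real n * p n ^ j) \<longlonglongrightarrow> 0"
    by (rule Lim_transform_eventually)
  show ?thesis
  proof (intro exI[of _ k] exI[of _ "\<lambda>n. clique_poly n k"] conjI allI impI)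
    fix t :: "nat \<Rightarrow> nat"
    assume t1: "\<forall>n. t n \<ge> 1" and "(\<lambda>n. real (t n)) \<in> O(\<lambda>_. 1)"
    then obtain c where "\<forall>\<^sub>F n in sequentially. norm (real (t n)) \<le> c * norm (1 :: real)"
      by (elim landau_o.bigE) auto
    then have "\<forall>\<^sub>F n in sequentially. t n \<le> nat \<lceil>c\<rceil>"
      by (rule eventually_mono) (simp, linarith)
    show "\<not> strongly_separates (\<lambda>n. signed_count n (p n) (star (t n)))
            (\<lambda>n. planted (clique_graph k) n (p n)) (\<lambda>n. erdos_renyi n (p n))"
      using p01 np t1[rule_format] \<open>\<forall>\<^sub>F n in sequentially. t n \<le> nat \<lceil>c\<rceil>\<close> by (rule stars_not_strongly_separate)
  next
    show "poly_vars (clique_poly n k) \<subseteq> nsets {1..n} 2" for n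
      by (rule poly_vars_clique_poly)
    show "(\<lambda>n. real (total_degree (clique_poly n k))) \<in> O(\<lambda>_. 1)"
      by (rule bigoI[of _ "real (k choose 2)"]) (simp add: total_degree_clique_poly)
    show "strongly_separates (\<lambda>n. eval_poly (clique_poly n k))
          (\<lambda>n. planted (clique_graph k) n (p n)) (\<lambda>n. erdos_renyi n (p n))"
      unfolding eval_clique_poly[OF k2, abs_def]
      by (rule clique_count_strongly_separates[OF p0 p1 k_def npj])
  qed
qed

end
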